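(* Let $n,s,t,\delta$ be integers with $s\ge 2$ and $3\le t+1\le \delta\le \left\lfloor \frac{n+t-2}{2}\right\rfloor$, and let $h=\left\lfloor \frac{n+t-2}{2}\right\rfloor$. Put $$f_1(n,t,\delta,s)=\binom{n+t-\delta-1}{s}+(\delta-t+1)\binom{\delta}{s-1},$$ $$g_1(n,t,\delta,s)=\binom{n+t-h-1}{s}+(h-t)\binom{h}{s-1}+\binom{\delta}{s-1}.$$ Let $G$ be a finite, simple, connected graph of order $n$ with minimum degree $\delta$. If $$N_s(G)>\max\{f_1(n,t,\delta,s),\,g_1(n,t,\delta,s)\},$$ then $G$ is one-to-many $t$-disjoint path coverable.
   Context: The order of a graph is its number of vertices. $N_s(G)$ is the number of $s$-cliques of $G$, i.e. of sets of exactly $s$ vertices of $G$ that are pairwise adjacent. A graph $G$ is one-to-many $t$-disjoint path coverable if for any vertex $u$ and any set $\{v_1,\dots,v_t\}$ of $t$ distinct vertices of $G$ not containing $u$, there exist $t$ paths $P_1,\dots,P_t$ in $G$ such that $P_i$ joins $u$ and $v_i$, every vertex of $G$ lies on at least one of the paths, and any two of the paths have no common vertex other than $u$. Binomial coefficients $\binom{a}{b}$ with integers $0\le a<b$ are $0$. *)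

theory Defs
  imports "Graph_Theory.Graph_Theory"
begin

text \<open>
  A finite simple graph is a \<^locale>\<open>pair_graph\<close>: a finite vertex set with a symmetric,
  irreflexive arc relation on it, each edge being represented by its two orientations.
\<close>

text \<open>By symmetry of the arc relation, the out-degree of a vertex is its number of neighbours.\<close>

definition min_degree :: "'a pair_pre_digraph \<Rightarrow> nat" where
  "min_degree G = Min (out_degree (with_proj G) ` pverts G)"

definition cliques :: "'a pair_pre_digraph \<Rightarrow> nat \<Rightarrow> 'a set set" where
  "cliques G s =
    {K. K \<subseteq> pverts G \<and> finite K \<and> card K = s \<and>
        (\<forall>x\<in>K. \<forall>y\<in>K. x \<noteq> y \<longrightarrow> (x, y) \<in> parcs G)}"

definition num_cliques :: "'a pair_pre_digraph \<Rightarrow> nat \<Rightarrow> nat" where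
  "num_cliques G s = card (cliques G s)"

text \<open>The path to the end vertex \<open>v \<in> S\<close> is \<open>P v\<close>, given as its list of vertices.\<close>

definition one_to_many_disjoint_path_coverable :: "nat \<Rightarrow> 'a pair_pre_digraph \<Rightarrow> bool" where
  "one_to_many_disjoint_path_coverable t G \<longleftrightarrow>
    (\<forall>u S. u \<in> pverts G \<and> S \<subseteq> pverts G \<and> finite S \<and> card S = t \<and> u \<notin> S \<longrightarrow>
      (\<exists>P. (\<forall>v\<in>S. vpath (P v) (with_proj G) \<and> hd (P v) = u \<and> last (P v) = v) \<and>
           (\<Union>v\<in>S. set (P v)) = pverts G \<and>
           (\<forall>v\<in>S. \<forall>w\<in>S. v \<noteq> w \<longrightarrow> set (P v) \<inter> set (P w) = {u})))"

text \<open>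
  The bounds are used only for \<open>3 \<le> t + 1 \<le> \<delta> \<le> h_bound n t\<close> and \<open>s \<ge> 2\<close>;
  in that range none of the subtractions below is truncated.
\<close>

definition h_bound :: "nat \<Rightarrow> nat \<Rightarrow> nat" where
  "h_bound n t = (n + t - 2) div 2"

definition f1 :: "nat \<Rightarrow> nat \<Rightarrow> nat \<Rightarrow> nat \<Rightarrow> nat" where
  "f1 n t \<delta> s = ((n + t - \<delta> - 1) choose s) + (\<delta> - t + 1) * (\<delta> choose (s - 1))"

definition g1 :: "nat \<Rightarrow> nat \<Rightarrow> nat \<Rightarrow> nat \<Rightarrow> nat" where
  "g1 n t \<delta> s = (let h = h_bound n t in
    ((n + t - h - 1) choose s) + (h - t) * (h choose (s - 1)) + (\<delta> choose (s - 1)))"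

end

theory Submission
  imports Defs
begin

text \<open>
  A covering by disjoint paths from \<open>u\<close> to the vertices of \<open>S\<close> is a spanning spider with body \<open>u\<close>
  and set of feet \<open>S\<close>. As in the Bondy--Chvatal closure for Hamiltonicity, if adding an edge
  between the nonadjacent vertices \<open>x\<close> and \<open>y\<close> creates a spanning spider where there was none, then
  rerouting shows \<open>d(x) + d(y) \<le> n + t - 2\<close>. So if \<open>G\<close> has no spanning spider, it extends to an
  edge-maximal such graph, in which all nonadjacent pairs satisfy this bound. Take a nonadjacent
  pair \<open>x, y\<close> with largest degree sum in that graph and put \<open>k = d(x) \<le> d(y)\<close>: the at least
  \<open>k - t + 1\<close> non-neighbours of \<open>y\<close> all have degree at most \<open>k\<close>. One of them may be exchanged for a
  vertex of degree \<open>\<delta>\<close>; counting the cliques of \<open>G\<close> that meet the resulting set and those that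
  avoid it bounds their number by a function of \<open>k\<close> which is convex on \<open>[\<delta>, h]\<close> and whose end
  values are \<open>f\<^sub>1\<close> and \<open>g\<^sub>1\<close>.
\<close>

section \<open>Spanning spiders and path covers\<close>

text \<open>Vertex set and edge relation are separate arguments, so that edges can be added or
  removed while the vertices stay fixed.\<close>

definition spider :: "'a set \<Rightarrow> ('a \<times> 'a) set \<Rightarrow> 'a \<Rightarrow> 'a set \<Rightarrow> ('a \<Rightarrow> 'a list) \<Rightarrow> bool" where
  "spider V E u S P \<longleftrightarrow>
    (\<forall>v\<in>S. P v \<noteq> [] \<and> distinct (P v) \<and> successively (\<lambda>a b. (a, b) \<in> E) (P v) \<and>
           hd (P v) = u \<and> last (P v) = v) \<and>
    (\<Union>v\<in>S. set (P v)) = V \<and>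
    (\<forall>v\<in>S. \<forall>w\<in>S. v \<noteq> w \<longrightarrow> set (P v) \<inter> set (P w) = {u})"

lemma spiderD:
  assumes "spider V E u S P" "v \<in> S"
  shows "P v \<noteq> []" "distinct (P v)" "successively (\<lambda>a b. (a, b) \<in> E) (P v)"
    "hd (P v) = u" "last (P v) = v" "u \<in> set (P v)" "v \<in> set (P v)" "set (P v) \<subseteq> V"
proof -
  show 1: "P v \<noteq> []" "distinct (P v)" "successively (\<lambda>a b. (a, b) \<in> E) (P v)"
    "hd (P v) = u" "last (P v) = v" "set (P v) \<subseteq> V"
    using assms unfolding spider_def by auto
  show "u \<in> set (P v)" "v \<in> set (P v)"
    using hd_in_set[OF 1(1)] last_in_set[OF 1(1)] 1(4,5) by simp_all
qed

lemma spider_legs_disjoint: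
  assumes "spider V E u S P" "v \<in> S" "w \<in> S" "z \<in> set (P v)" "z \<in> set (P w)" "z \<noteq> u"
  shows "v = w"
  using assms unfolding spider_def by blast

lemma vwalk_arcs_subset_iff_successively:
  "set (vwalk_arcs p) \<subseteq> A \<longleftrightarrow> successively (\<lambda>a b. (a, b) \<in> A) p"
  by (induction p rule: vwalk_arcs.induct) auto

lemma one_to_many_disjoint_path_coverable_iff_spider:
  "one_to_many_disjoint_path_coverable t G \<longleftrightarrow>
    (\<forall>u S. u \<in> pverts G \<and> S \<subseteq> pverts G \<and> finite S \<and> card S = t \<and> u \<notin> S \<longrightarrow>
      (\<exists>P. spider (pverts G) (parcs G) u S P))"
proof -
  have "(\<forall>v\<in>S. vpath (P v) (with_proj G) \<and> hd (P v) = u \<and> last (P v) = v) \<and>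
      (\<Union>v\<in>S. set (P v)) = pverts G \<and>
      (\<forall>v\<in>S. \<forall>w\<in>S. v \<noteq> w \<longrightarrow> set (P v) \<inter> set (P w) = {u}) \<longleftrightarrow>
      spider (pverts G) (parcs G) u S P" for u S P
    unfolding spider_def vpath_def vwalk_def
    by (auto simp: vwalk_arcs_subset_iff_successively)
  then show ?thesis
    unfolding one_to_many_disjoint_path_coverable_def by simp
qed

text \<open>One leg absorbs every vertex outside \<open>S\<close>, and all other legs are single
  edges at \<open>u\<close>. This shows later that a spiderless graph has a nonadjacent
  pair.\<close>

lemma spider_complete:
  assumes "finite V" "u \<in> V" "S \<subseteq> V" "S \<noteq> {}" "u \<notin> S"
    and E: "\<And>a b. a \<in> V \<Longrightarrow> b \<in> V \<Longrightarrow> a \<noteq> b \<Longrightarrow> (a, b) \<in> E"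
  shows "\<exists>P. spider V E u S P"
proof -
  obtain v0 where v0: "v0 \<in> S" using assms by auto
  obtain zs where zs: "set zs = V - insert u S" "distinct zs"
    using finite_distinct_list[of "V - insert u S"] assms(1) by auto
  define P where "P v = (if v = v0 then u # zs @ [v0] else [u, v])" for v
  have path: "successively (\<lambda>a b. (a, b) \<in> E) p" if "distinct p" "set p \<subseteq> V" for p
    using that by (induction p rule: induct_list012) (auto intro: E)
  have "distinct (P v) \<and> set (P v) \<subseteq> V" if "v \<in> S" for v
    using that assms v0 zs by (auto simp: P_def)
  with path have "P v \<noteq> [] \<and> distinct (P v) \<and> successively (\<lambda>a b. (a, b) \<in> E) (P v) \<and>
           hd (P v) = u \<and> last (P v) = v" if "v \<in> S" for v
    using that by (auto simp: P_def)
  moreover have "set (P v) = (if v = v0 then {v0} \<union> (V - S) else {u, v})" for v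
    using zs assms by (auto simp: P_def)
  then have "(\<Union>v\<in>S. set (P v)) = V"
    and "\<forall>v\<in>S. \<forall>w\<in>S. v \<noteq> w \<longrightarrow> set (P v) \<inter> set (P w) = {u}"
    using v0 assms by (auto split: if_splits)
  ultimately have "spider V E u S P"
    unfolding spider_def by blast
  then show ?thesis by blast
qed

section \<open>Rerouting a spider by exchanging two edges\<close>

text \<open>No leg changes its vertex set, so covering and disjointness are inherited;
  \<open>A\<close> and \<open>C\<close> are nonempty, so the ends of the leg stay in place. The
  given spider may use edges of a larger \<open>F\<close>: only the edges inside the three pieces
  and on the other legs must lie in \<open>E\<close>, not the two joining the pieces.\<close>

lemma spider_reverse_segment:
  assumes P: "spider V F u S P" and v0: "v0 \<in> S" "P v0 = A @ B @ C"
    and ne: "A \<noteq> []" "B \<noteq> []" "C \<noteq> []" and "sym E"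
    and paths: "successively (\<lambda>a b. (a, b) \<in> E) A" "successively (\<lambda>a b. (a, b) \<in> E) B"
      "successively (\<lambda>a b. (a, b) \<in> E) C"
    and legs: "\<And>v. v \<in> S \<Longrightarrow> v \<noteq> v0 \<Longrightarrow> successively (\<lambda>a b. (a, b) \<in> E) (P v)"
    and new: "(last A, last B) \<in> E" "(hd B, hd C) \<in> E"
  shows "\<exists>Q. spider V E u S Q"
proof -
  define Q where "Q = P(v0 := A @ rev B @ C)"
  have flip: "(\<lambda>a b. (b, a) \<in> E) = (\<lambda>a b. (a, b) \<in> E)"
    using \<open>sym E\<close> by (auto simp: sym_def fun_eq_iff)
  have set_Q: "set (Q v) = set (P v)" for v
    by (simp add: Q_def v0)
  have "successively (\<lambda>a b. (a, b) \<in> E) (rev B)"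
    unfolding successively_rev flip by (rule paths)
  then have "successively (\<lambda>a b. (a, b) \<in> E) (A @ rev B @ C)"
    using paths new ne
    by (simp add: successively_append_iff hd_append hd_rev last_rev del: successively_rev)
  moreover have "distinct (A @ rev B @ C)" "hd (A @ rev B @ C) = u" "last (A @ rev B @ C) = v0"
    using spiderD[OF P v0(1)] v0(2) ne by auto
  ultimately have "Q v \<noteq> [] \<and> distinct (Q v) \<and> successively (\<lambda>a b. (a, b) \<in> E) (Q v) \<and>
           hd (Q v) = u \<and> last (Q v) = v" if "v \<in> S" for v
    using spiderD[OF P that] legs[OF that] ne by (simp add: Q_def)
  then have "spider V E u S Q"
    using P unfolding spider_def set_Q by blast
  then show ?thesis by blast
qed

text \<open>Each tail keeps its foot, so the leg to \<open>v\<close> becomes \<open>C @ B\<close>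
  and the leg to \<open>w\<close> becomes \<open>A @ D\<close>. Both initial pieces start at
  \<open>u\<close>, and the old legs meet only there, hence so do the new ones.\<close>

lemma spider_swap_tails:
  assumes P: "spider V F u S P" and S: "v \<in> S" "w \<in> S" "v \<noteq> w"
    and split: "P v = A @ B" "P w = C @ D" "A \<noteq> []" "B \<noteq> []" "C \<noteq> []" "D \<noteq> []"
    and paths: "successively (\<lambda>a b. (a, b) \<in> E) A" "successively (\<lambda>a b. (a, b) \<in> E) B"
      "successively (\<lambda>a b. (a, b) \<in> E) C" "successively (\<lambda>a b. (a, b) \<in> E) D"
    and legs: "\<And>z. z \<in> S \<Longrightarrow> z \<noteq> v \<Longrightarrow> z \<noteq> w \<Longrightarrow> successively (\<lambda>a b. (a, b) \<in> E) (P z)"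
    and new: "(last A, hd D) \<in> E" "(last C, hd B) \<in> E"
  shows "\<exists>Q. spider V E u S Q"
proof -
  define Q where "Q = P(v := C @ B, w := A @ D)"
  have QS: "Q v = C @ B" "Q w = A @ D" "\<And>z. z \<noteq> v \<Longrightarrow> z \<noteq> w \<Longrightarrow> Q z = P z"
    using S by (auto simp: Q_def)
  have hd: "hd A = u" "hd C = u"
    using spiderD(4)[OF P S(1)] spiderD(4)[OF P S(2)] split by auto
  then have u: "u \<in> set A" "u \<in> set C"
    using hd_in_set[OF split(3)] hd_in_set[OF split(5)] by simp_all
  have dist: "distinct A" "distinct B" "distinct C" "distinct D"
      "set A \<inter> set B = {}" "set C \<inter> set D = {}"
    using spiderD(2)[OF P S(1)] spiderD(2)[OF P S(2)] split by auto
  have "set (P v) \<inter> set (P w) = {u}" using P S unfolding spider_def by blast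
  then have cross: "set (A @ B) \<inter> set (C @ D) = {u}" using split by simp
  have other: "set (A @ B) \<inter> set (P z) = {u}" "set (C @ D) \<inter> set (P z) = {u}"
    if "z \<in> S" "z \<noteq> v" "z \<noteq> w" for z
  proof -
    have "set (P v) \<inter> set (P z) = {u}" "set (P w) \<inter> set (P z) = {u}"
      using P S that unfolding spider_def by blast+
    then show "set (A @ B) \<inter> set (P z) = {u}" "set (C @ D) \<inter> set (P z) = {u}"
      by (simp_all only: split)
  qed
  have glue: "set C \<inter> set B = {}" "set A \<inter> set D = {}"
    using u dist cross by auto
  have "distinct (C @ B)" "distinct (A @ D)"
    using dist glue by simp_all
  moreover have "successively (\<lambda>a b. (a, b) \<in> E) (C @ B)" "successively (\<lambda>a b. (a, b) \<in> E) (A @ D)"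
    using paths new by (simp_all add: successively_append_iff)
  moreover have "hd (C @ B) = u" "hd (A @ D) = u" "last (C @ B) = v" "last (A @ D) = w"
    using spiderD(5)[OF P S(1)] spiderD(5)[OF P S(2)] split hd by simp_all
  ultimately have leg: "Q z \<noteq> [] \<and> distinct (Q z) \<and> successively (\<lambda>a b. (a, b) \<in> E) (Q z) \<and>
           hd (Q z) = u \<and> last (Q z) = z" if "z \<in> S" for z
    using spiderD(1-5)[OF P that] legs[OF that] split QS
    by (cases "z = v"; cases "z = w") simp_all
  have "(\<Union>z\<in>S. set (Q z)) = set (Q v) \<union> set (Q w) \<union> (\<Union>z\<in>S - {v, w}. set (Q z))"
    using S by blast
  also have "\<dots> = set (P v) \<union> set (P w) \<union> (\<Union>z\<in>S - {v, w}. set (P z))"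
    using QS split by auto
  also have "\<dots> = V" using P S unfolding spider_def by blast
  finally have union: "(\<Union>z\<in>S. set (Q z)) = V" .
  have Qvw: "set (Q v) \<inter> set (Q w) = {u}"
    using u dist cross by (auto simp: QS)
  have Qo: "set (Q v) \<inter> set (Q z) = {u}" "set (Q w) \<inter> set (Q z) = {u}"
    if "z \<in> S" "z \<noteq> v" "z \<noteq> w" for z
    using other[OF that] u that by (auto simp: QS)
  have "set (Q a) \<inter> set (Q b) = {u}" if "a \<in> S" "b \<in> S" "a \<noteq> b" for a b
  proof -
    have Pab: "set (P a) \<inter> set (P b) = {u}" using P that unfolding spider_def by blast
    consider "a \<in> {v, w}" "b \<in> {v, w}" | "a \<in> {v, w}" "b \<notin> {v, w}"
      | "a \<notin> {v, w}" "b \<in> {v, w}" | "a \<notin> {v, w}" "b \<notin> {v, w}"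
      by blast
    then show ?thesis
    proof cases
      case 1
      then have "set (Q a) \<inter> set (Q b) = set (Q v) \<inter> set (Q w)" using that by blast
      then show ?thesis using Qvw by simp
    next
      case 2
      then show ?thesis using Qo[OF that(2)] by blast
    next
      case 3
      then show ?thesis using Qo[OF that(1)] by blast
    next
      case 4
      then show ?thesis using Pab QS(3) by simp
    qed
  qed
  with leg union have "spider V E u S Q" unfolding spider_def by blast
  then show ?thesis by blast
qed

section \<open>Degree sums of nonadjacent pairs\<close>

lemma successively_insert_edge_cases:
  assumes "successively (\<lambda>a b. (a, b) \<in> insert (x, y) (insert (y, x) E)) p"
  shows "successively (\<lambda>a b. (a, b) \<in> E) p \<or> (\<exists>as bs. p = as @ x # y # bs \<or> p = as @ y # x # bs)"
proof (cases "successively (\<lambda>a b. (a, b) \<in> E) p")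
  case False
  then obtain i where i: "Suc i < length p" "(p ! i, p ! Suc i) \<notin> E"
    unfolding successively_conv_nth by blast
  then have "(p ! i, p ! Suc i) = (x, y) \<or> (p ! i, p ! Suc i) = (y, x)"
    using successively_nth[OF assms i(1)] by blast
  moreover have "p = take i p @ p ! i # p ! Suc i # drop (Suc (Suc i)) p"
    using i(1) by (metis Cons_nth_drop_Suc Suc_lessD append_take_drop_id)
  ultimately show ?thesis by (metis prod.inject)
qed simp

text \<open>Two disjoint subsets \<open>X\<close> and \<open>Y\<close> of \<open>V - {u, y}\<close>
  are built. All but one neighbour of \<open>x\<close> are charged to \<open>X\<close>, and all but
  \<open>card S - 1\<close> neighbours of \<open>y\<close> to \<open>Y\<close>. The sum is at most
  \<open>(card V - 2) + 1 + (card S - 1)\<close>. Here \<open>x\<close> precedes \<open>y\<close> on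
  the leg, seen from \<open>u\<close>.\<close>

lemma spider_insert_edge_degree_sum_oriented:
  fixes E :: "('a \<times> 'a) set"
  assumes fin: "finite V" "finite S" and S: "card S \<ge> 2" "u \<notin> S"
    and E: "E \<subseteq> V \<times> V" "sym E" "irrefl E" "(x, y) \<notin> E"
    and P: "spider V (insert (x, y) (insert (y, x) E)) u S P"
    and leg0: "v0 \<in> S" "P v0 = ps @ x # y # qs"
    and none: "\<nexists>Q. spider V E u S Q"
  shows "card (E `` {x}) + card (E `` {y}) + 2 \<le> card V + card S"
proof -
  let ?F = "insert (x, y) (insert (y, x) E)"
  let ?N = "\<lambda>z. E `` {z}"
  define L where "L = set (P v0)"
  have symE: "(b, a) \<in> E" if "(a, b) \<in> E" for a b using that \<open>sym E\<close> by (rule symD[rotated])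
  have L_eq: "L = set (ps @ [x]) \<union> set (y # qs)" by (auto simp: L_def leg0)
  have d0: "distinct (ps @ x # y # qs)" using spiderD(2)[OF P leg0(1)] leg0 by simp
  have hd0: "hd (ps @ [x]) = u" using spiderD(4)[OF P leg0(1)] leg0(2) by (cases ps) auto
  have last0: "last (y # qs) = v0" using spiderD(5)[OF P leg0(1)] leg0(2) by simp
  have u_ps: "u \<in> set (ps @ [x])" using hd0 by (metis hd_in_set snoc_eq_iff_butlast)
  have yu: "y \<noteq> u" using u_ps d0 by auto
  have uL: "u \<in> L" and v0L: "v0 \<in> L" and yL: "y \<in> L" and LV: "L \<subseteq> V"
    using spiderD[OF P leg0(1)] leg0(2) by (auto simp: L_def)
  have uV: "u \<in> V" "y \<in> V" using LV uL yL by auto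
  have V_eq: "V = (\<Union>v\<in>S. set (P v))" using P unfolding spider_def by blast
  have drop_edge: "successively (\<lambda>a b. (a, b) \<in> E) p"
    if "successively (\<lambda>a b. (a, b) \<in> ?F) p" "x \<notin> set p \<or> y \<notin> set p" for p
    using that by (auto elim!: successively_mono)
  have "successively (\<lambda>a b. (a, b) \<in> ?F) (ps @ [x])" "successively (\<lambda>a b. (a, b) \<in> ?F) (y # qs)"
    using spiderD(3)[OF P leg0(1)] unfolding leg0(2)
    by (simp_all add: successively_append_iff successively_Cons)
  then have path0: "successively (\<lambda>a b. (a, b) \<in> E) (ps @ [x])"
      "successively (\<lambda>a b. (a, b) \<in> E) (y # qs)"
    using d0 by (auto intro!: drop_edge)
  have legs: "successively (\<lambda>a b. (a, b) \<in> E) (P v)" if "v \<in> S" "v \<noteq> v0" for v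
    using spiderD(3)[OF P that(1)] spider_legs_disjoint[OF P that(1) leg0(1), of y] that yL yu
    by (auto intro!: drop_edge simp: L_def)

  \<comment> \<open>Edges of the spider are directed away from \<open>u\<close>. A vertex has at
    most one predecessor, since the legs share only \<open>u\<close>; but \<open>u\<close> itself
    has a successor on every leg.\<close>
  define succ where "succ a b \<longleftrightarrow> (\<exists>v\<in>S. \<exists>as bs. P v = as @ a # b # bs)" for a b
  have succ_ex: "\<exists>b. succ a b \<and> b \<in> set (P v) \<and> b \<noteq> u"
    if a: "v \<in> S" "a \<in> set (P v)" "a \<noteq> v" for v a
  proof -
    obtain as cs where P_v: "P v = as @ a # cs" using split_list[OF a(2)] by blast
    then obtain b bs where cs: "cs = b # bs" using a spiderD(5)[OF P a(1)] by (cases cs) auto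
    then have "b \<noteq> u"
      using spiderD(2,4)[OF P a(1)] P_v by (cases as) auto
    then show ?thesis using P_v cs a unfolding succ_def by auto
  qed
  have succ_unique: "a = a'" if ab: "succ a b" "succ a' b" for a a' b
  proof -
    obtain v as bs where v: "v \<in> S" "P v = as @ a # b # bs" using ab succ_def by auto
    obtain w as' bs' where w: "w \<in> S" "P w = as' @ a' # b # bs'" using ab succ_def by auto
    have "b \<noteq> u" using spiderD(2,4)[OF P v(1)] v(2) by (cases as) auto
    then have "v = w" using spider_legs_disjoint[OF P v(1) w(1), of b] v w by auto
    then have "(as @ [a]) @ b # bs = (as' @ [a']) @ b # bs'" using v w by simp
    moreover have "distinct ((as @ [a]) @ b # bs)" using spiderD(2)[OF P v(1)] v(2) by simp
    ultimately have "as @ [a] = as' @ [a']"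
      by (subst (asm) append_Cons_eq_iff) auto
    then show ?thesis by simp
  qed
  \<comment> \<open>The choice is arbitrary at \<open>u\<close>, which has no predecessor; every
    other vertex of \<open>V\<close> has exactly one.\<close>
  define pre where "pre b = (SOME a. succ a b)" for b
  have pre_eq: "pre b = a" if "succ a b" for a b
    unfolding pre_def using someI[of "\<lambda>a. succ a b", OF that] that succ_unique by blast
  have succ_xy: "succ x y" unfolding succ_def using leg0 by blast

  \<comment> \<open>Every \<open>b \<noteq> u\<close> stands for the edge from \<open>pre b\<close> to \<open>b\<close> of the spider, oriented away from \<open>u\<close>.
    After removal of the edge \<open>xy\<close>, an edge in both \<open>X\<close> and \<open>Y\<close> could be exchanged for two edges at
    \<open>x\<close> and \<open>y\<close>: on the leg of \<open>x\<close> and \<open>y\<close> a segment is reversed, otherwise two legs swap tails.\<close>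
  define X where "X = {b \<in> V - {u, y}. if b \<in> L then (x, pre b) \<in> E else (x, b) \<in> E}"
  define Y where "Y = {b \<in> V - {u, y}. if b \<in> L then (y, b) \<in> E else (y, pre b) \<in> E}"
  have "X \<inter> Y = {}"
  proof (rule ccontr)
    assume "X \<inter> Y \<noteq> {}"
    then obtain b where b: "b \<in> X" "b \<in> Y" by auto
    then have bV: "b \<in> V" "b \<noteq> u" "b \<noteq> y" by (auto simp: X_def)
    then obtain v where v: "v \<in> S" "b \<in> set (P v)" using V_eq by blast
    then obtain cs bs where csbs: "P v = cs @ b # bs" by (meson split_list)
    moreover have "cs \<noteq> []" using csbs spiderD(4)[OF P v(1)] bV by auto
    ultimately obtain as a where P_v: "P v = as @ a # b # bs"
      by (metis append.assoc append_Cons append_Nil rev_exhaust)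
    then have pre: "pre b = a" using v by (intro pre_eq) (auto simp: succ_def)
    show False
    proof (cases "v = v0")
      case True
      then have "b \<in> L" using v by (simp add: L_def)
      then have adj: "(x, a) \<in> E" "(y, b) \<in> E" using b pre by (auto simp: X_def Y_def)
      have eq: "(as @ [a]) @ (b # bs) = (ps @ [x]) @ (y # qs)" using True P_v leg0 by simp
      \<comment> \<open>Either \<open>a\<close> and \<open>b\<close> lie on the part from
        \<open>y\<close> on, and the segment from \<open>y\<close> to \<open>a\<close> is reversed,
        or they lie on the part up to \<open>x\<close>, and the segment from \<open>b\<close> to
        \<open>x\<close> is. The segment is nonempty because \<open>b\<close> differs from
        \<open>y\<close>.\<close>
      then consider cs where "as @ [a] = (ps @ [x]) @ cs" "cs @ b # bs = y # qs"
        | cs where "(as @ [a]) @ cs = ps @ [x]" "b # bs = cs @ y # qs"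
        unfolding append_eq_append_conv2 by metis
      then show False
      proof cases
        case 1
        then have ne: "cs \<noteq> []" using bV by auto
        then have "last cs = a" "hd cs = y" using 1
          by (metis last_append last_snoc, metis hd_append2 list.sel(1))
        moreover have "P v0 = (ps @ [x]) @ cs @ (b # bs)" using leg0 1 by simp
        moreover have "successively (\<lambda>a b. (a, b) \<in> E) cs" "successively (\<lambda>a b. (a, b) \<in> E) (b # bs)"
          using path0(2) unfolding 1(2)[symmetric] successively_append_iff by auto
        ultimately show False
          using none spider_reverse_segment[OF P leg0(1), of "ps @ [x]" cs "b # bs" E]
            ne path0 legs adj \<open>sym E\<close> by auto
      next
        case 2
        then have ne: "cs \<noteq> []" using bV by auto
        then have "last cs = x" "hd cs = b" using 2
          by (metis last_append last_snoc, metis hd_append2 list.sel(1))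
        moreover have "P v0 = (as @ [a]) @ cs @ (y # qs)" using leg0 2 by simp
        moreover have "successively (\<lambda>a b. (a, b) \<in> E) (as @ [a])" "successively (\<lambda>a b. (a, b) \<in> E) cs"
          using path0(1) unfolding 2(1)[symmetric] successively_append_iff by auto
        ultimately show False
          using none spider_reverse_segment[OF P leg0(1), of "as @ [a]" cs "y # qs" E]
            ne path0 legs adj symE \<open>sym E\<close> by auto
      qed
    next
      case False
      then have "b \<notin> L" using v bV spider_legs_disjoint[OF P v(1) leg0(1)] by (auto simp: L_def)
      then have adj: "(x, b) \<in> E" "(y, a) \<in> E" using b pre by (auto simp: X_def Y_def)
      have split: "P v0 = (ps @ [x]) @ (y # qs)" "P v = (as @ [a]) @ (b # bs)"
        using leg0 P_v by auto
      have "successively (\<lambda>a b. (a, b) \<in> E) (as @ [a])" "successively (\<lambda>a b. (a, b) \<in> E) (b # bs)"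
        using legs[OF v(1) False] unfolding split(2) successively_append_iff by auto
      then show False
        using none spider_swap_tails[OF P leg0(1) v(1) _ split, of E] False
          path0 legs adj symE by auto
    qed
  qed

  have finX: "finite X" and finY: "finite Y" and finL: "finite L"
    using fin by (auto simp: X_def Y_def L_def)
  have NV: "?N z \<subseteq> V" for z using E(1) by auto
  have finN: "finite (?N z)" for z using NV fin(1) finite_subset by blast
  have y_nx: "y \<notin> ?N x" "x \<notin> ?N y" "x \<notin> ?N x" "y \<notin> ?N y"
    using E symE by (auto simp: irrefl_def)
  \<comment> \<open>A neighbour of \<open>x\<close> on its own leg is charged to its successor,
    which only the foot \<open>v0\<close> lacks; a neighbour on another leg is charged to itself.
    The successor is never \<open>y\<close>, whose predecessor \<open>x\<close> is not its own
    neighbour.\<close>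
  have "?N x \<subseteq> {v0} \<union> pre ` (X \<inter> L) \<union> (X - L)"
  proof
    fix a assume a: "a \<in> ?N x"
    show "a \<in> {v0} \<union> pre ` (X \<inter> L) \<union> (X - L)"
    proof (cases "a \<in> L \<and> a \<noteq> v0")
      case True
      then obtain b where b: "succ a b" "b \<in> L" "b \<noteq> u" using succ_ex[OF leg0(1)] by (auto simp: L_def)
      have "b \<noteq> y" using b(1) succ_xy succ_unique a y_nx by blast
      then have "b \<in> X \<inter> L" using b a LV pre_eq[OF b(1)] by (auto simp: X_def)
      then show ?thesis using pre_eq[OF b(1)] by blast
    next
      case False
      then show ?thesis using a NV uL yL by (auto simp: X_def)
    qed
  qed
  then have "card (?N x) \<le> card ({v0} \<union> pre ` (X \<inter> L) \<union> (X - L))"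
    using finX by (intro card_mono) auto
  also have "\<dots> \<le> 1 + card (X \<inter> L) + card (X - L)"
    using finX by (intro order_trans[OF card_Un_le] add_mono) (auto intro!: card_image_le)
  also have "\<dots> = 1 + card X"
    using card_Un_disjoint[of "X \<inter> L" "X - L"] finX by (simp add: Int_Diff_Un Int_Diff_disjoint)
  finally have dx: "card (?N x) \<le> card X + 1" by simp

  \<comment> \<open>For \<open>y\<close> the charging is reversed: neighbours on its own leg, except
    \<open>u\<close>, count themselves, and those on other legs, except the feet, count their
    successors.\<close>
  have Ny_L: "?N y \<inter> L \<subseteq> (?N y \<inter> {u}) \<union> (Y \<inter> L)"
    using NV y_nx by (auto simp: Y_def)
  have Ny_out: "\<exists>b. succ a b \<and> b \<in> Y - L" if a: "a \<in> ?N y - L - (S - {v0})" for a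
  proof -
    obtain v where v: "v \<in> S" "a \<in> set (P v)" using a NV V_eq by blast
    then have vv0: "v \<noteq> v0" using a by (auto simp: L_def)
    then have "a \<noteq> v" using a v by blast
    then obtain b where b: "succ a b" "b \<in> set (P v)" "b \<noteq> u" using succ_ex[OF v] by blast
    then have "b \<notin> L" using spider_legs_disjoint[OF P v(1) leg0(1)] vv0 by (auto simp: L_def)
    then show ?thesis using b v a yL pre_eq[OF b(1)] V_eq by (auto simp: Y_def)
  qed
  have split_L: "card (?N y) = card (?N y \<inter> L) + card (?N y - L)" "card Y = card (Y \<inter> L) + card (Y - L)"
    by (metis Int_Diff_Un Int_Diff_disjoint card_Un_disjoint finN finY finite_Diff finite_Int)+
  have S': "card (S - {v0}) = card S - 1" using leg0 by simp
  have dy: "card (?N y) \<le> card Y + (card S - 1)"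
  proof (cases "u \<in> ?N y")
    case True
    \<comment> \<open>The first edge of another leg is in \<open>Y\<close> but has tail \<open>u \<in> L\<close>, which compensates for the
      neighbour \<open>u\<close> of \<open>y\<close> that is missed on its own leg.\<close>
    have "S - {v0} \<noteq> {}"
      using S' S(1) by (metis card.empty diff_is_0_eq not_less_eq_eq one_add_one plus_1_eq_Suc)
    then obtain v where v: "v \<in> S" "v \<noteq> v0" by auto
    obtain f where f: "succ u f" "f \<in> set (P v)" "f \<noteq> u"
      using succ_ex[OF v(1) spiderD(6)[OF P v(1)]] v S by auto
    then have "f \<notin> L" using spider_legs_disjoint[OF P v(1) leg0(1)] v by (auto simp: L_def)
    then have fY: "f \<in> Y - L" using f v True yL pre_eq[OF f(1)] V_eq by (auto simp: Y_def)
    have "?N y - L \<subseteq> (S - {v0}) \<union> pre ` (Y - L - {f})"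
    proof
      fix a assume a: "a \<in> ?N y - L"
      show "a \<in> (S - {v0}) \<union> pre ` (Y - L - {f})"
      proof (cases "a \<in> S - {v0}")
        case False
        then obtain b where b: "succ a b" "b \<in> Y - L" using Ny_out a by blast
        have "b \<noteq> f" using b(1) f(1) succ_unique a uL by blast
        then show ?thesis using b pre_eq[OF b(1)] by blast
      qed simp
    qed
    then have "card (?N y - L) \<le> card ((S - {v0}) \<union> pre ` (Y - L - {f}))"
      using finY fin by (intro card_mono) auto
    also have "\<dots> \<le> card S - 1 + card (Y - L - {f})"
      using finY S' by (intro order_trans[OF card_Un_le] add_mono) (auto intro!: card_image_le)
    also have "\<dots> = card S - 1 + (card (Y - L) - 1)" using fY finY by simp
    finally have "card (?N y - L) \<le> card S - 1 + (card (Y - L) - 1)" .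
    moreover have "card (Y - L) \<ge> 1"
      using fY finY by (metis One_nat_def Suc_leI card_gt_0_iff empty_iff finite_Diff)
    moreover have "card (?N y \<inter> L) \<le> 1 + card (Y \<inter> L)"
    proof -
      have "card (?N y \<inter> L) \<le> card ({u} \<union> (Y \<inter> L))" using Ny_L finY by (intro card_mono) auto
      also have "\<dots> \<le> card {u} + card (Y \<inter> L)" by (rule card_Un_le)
      finally show ?thesis by simp
    qed
    ultimately show ?thesis using split_L by linarith
  next
    case False
    have "?N y - L \<subseteq> (S - {v0}) \<union> pre ` (Y - L)"
      using Ny_out pre_eq by blast
    then have "card (?N y - L) \<le> card ((S - {v0}) \<union> pre ` (Y - L))"
      using finY fin by (intro card_mono) auto
    also have "\<dots> \<le> card S - 1 + card (Y - L)"
      using finY S' by (intro order_trans[OF card_Un_le] add_mono) (auto intro!: card_image_le)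
    finally have "card (?N y - L) \<le> card S - 1 + card (Y - L)" .
    moreover have "card (?N y \<inter> L) \<le> card (Y \<inter> L)"
      using Ny_L False finY by (intro card_mono) auto
    ultimately show ?thesis using split_L by linarith
  qed

  have "card X + card Y = card (X \<union> Y)"
    using \<open>X \<inter> Y = {}\<close> finX finY by (simp add: card_Un_disjoint)
  also have "\<dots> \<le> card (V - {u, y})"
    using fin by (intro card_mono) (auto simp: X_def Y_def)
  also have "\<dots> = card V - 2" using uV yu by (simp add: card_Diff_subset)
  finally have "card X + card Y \<le> card V - 2" .
  moreover have "card V \<ge> 2" using uV yu fin card_mono[of V "{u, y}"] by simp
  ultimately show ?thesis using dx dy S(1) by linarith
qed

text \<open>A spider avoiding the new edge would already exist in \<open>E\<close>, so some leg runs
  through it in one of two directions. The bound is symmetric in \<open>x\<close> and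
  \<open>y\<close>, so the oriented version covers both.\<close>

lemma spider_insert_edge_degree_sum:
  fixes E :: "('a \<times> 'a) set"
  assumes "finite V" "finite S" "card S \<ge> 2" "u \<notin> S"
    and "E \<subseteq> V \<times> V" "sym E" "irrefl E" "(x, y) \<notin> E"
    and P: "spider V (insert (x, y) (insert (y, x) E)) u S P"
    and none: "\<nexists>Q. spider V E u S Q"
  shows "card (E `` {x}) + card (E `` {y}) + 2 \<le> card V + card S"
proof -
  have "\<exists>v\<in>S. \<not> successively (\<lambda>a b. (a, b) \<in> E) (P v)"
    using none P unfolding spider_def by blast
  then obtain v as bs where "v \<in> S" "P v = as @ x # y # bs \<or> P v = as @ y # x # bs"
    using successively_insert_edge_cases spiderD(3)[OF P] by metis
  moreover have "(y, x) \<notin> E" using assms by (meson symD)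
  moreover have "spider V (insert (y, x) (insert (x, y) E)) u S P"
    using P by (simp add: insert_commute)
  ultimately show ?thesis
    using spider_insert_edge_degree_sum_oriented[of V S u E x y P v as bs]
      spider_insert_edge_degree_sum_oriented[of V S u E y x P v as bs] assms
    by (auto simp: add.commute)
qed

section \<open>Edge-maximal spiderless graphs\<close>

lemma obtain_maximal_spiderless:
  fixes E :: "('a \<times> 'a) set"
  assumes "finite V" "finite S" "card S \<ge> 2" "u \<notin> S"
    and "E \<subseteq> V \<times> V" "sym E" "irrefl E" "\<nexists>Q. spider V E u S Q"
  obtains M where "E \<subseteq> M" "M \<subseteq> V \<times> V" "sym M" "irrefl M" "\<nexists>Q. spider V M u S Q"
    "\<And>x y. x \<in> V \<Longrightarrow> y \<in> V \<Longrightarrow> x \<noteq> y \<Longrightarrow> (x, y) \<notin> M \<Longrightarrow>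
      card (M `` {x}) + card (M `` {y}) + 2 \<le> card V + card S"
proof -
  define \<M> where "\<M> = {M. E \<subseteq> M \<and> M \<subseteq> V \<times> V \<and> sym M \<and> irrefl M \<and> (\<nexists>Q. spider V M u S Q)}"
  have "\<M> \<subseteq> Pow (V \<times> V)" by (auto simp: \<M>_def)
  then have "finite \<M>" using assms(1) by (meson finite_Pow_iff finite_SigmaI finite_subset)
  moreover have "E \<in> \<M>" using assms by (simp add: \<M>_def)
  ultimately obtain M where M: "M \<in> \<M>" "\<And>M'. M' \<in> \<M> \<Longrightarrow> M \<subseteq> M' \<Longrightarrow> M = M'"
    using finite_has_maximal[of \<M>] by (metis empty_iff)
  have "card (M `` {x}) + card (M `` {y}) + 2 \<le> card V + card S"
    if xy: "x \<in> V" "y \<in> V" "x \<noteq> y" "(x, y) \<notin> M" for x y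
  proof -
    let ?M' = "insert (x, y) (insert (y, x) M)"
    have "?M' \<notin> \<M>" using M(2)[of ?M'] xy by blast
    moreover have "E \<subseteq> ?M'" "?M' \<subseteq> V \<times> V" "sym ?M'" "irrefl ?M'"
      using M(1) xy unfolding \<M>_def by (auto simp: sym_def irrefl_def)
    ultimately obtain P where "spider V ?M' u S P" unfolding \<M>_def by blast
    then show ?thesis
      using M(1) xy assms by (intro spider_insert_edge_degree_sum[of V S u M x y P]) (auto simp: \<M>_def)
  qed
  with M(1) show ?thesis using that unfolding \<M>_def by blast
qed

section \<open>Counting cliques\<close>

text \<open>A clique either avoids \<open>A\<close> or consists of some \<open>a\<close> in
  \<open>A\<close> and \<open>s - 1\<close> neighbours of \<open>a\<close>. Multiple counting and
  neighbour sets that are not cliques only enlarge the bound.\<close>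

lemma num_cliques_le:
  assumes G: "pair_graph G" and A: "A \<subseteq> pverts G"
  shows "num_cliques G s \<le>
    (card (pverts G - A) choose s) + (\<Sum>a\<in>A. card (parcs G `` {a}) choose (s - 1))"
proof -
  interpret pair_graph G by (rule G)
  let ?N = "\<lambda>a. parcs G `` {a}"
  have finV: "finite (pverts G)" by (rule pair_finite_verts)
  have finA: "finite A" using A finV by (rule finite_subset)
  have finN: "finite (?N a)" for a
    using finV by (rule finite_subset[rotated]) (auto dest: in_arcsD2)
  define \<B> where "\<B> a = insert a ` {L. L \<subseteq> ?N a \<and> card L = s - 1}" for a
  have "cliques G s \<subseteq> {K. K \<subseteq> pverts G - A \<and> card K = s} \<union> (\<Union>a\<in>A. \<B> a)"
  proof
    fix K assume K: "K \<in> cliques G s"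
    show "K \<in> {K. K \<subseteq> pverts G - A \<and> card K = s} \<union> (\<Union>a\<in>A. \<B> a)"
    proof (cases "K \<inter> A = {}")
      case True
      then show ?thesis using K by (auto simp: cliques_def)
    next
      case False
      then obtain a where a: "a \<in> K" "a \<in> A" by auto
      then have "K = insert a (K - {a})" "K - {a} \<subseteq> ?N a" "card (K - {a}) = s - 1"
        using K by (auto simp: cliques_def)
      then show ?thesis using a unfolding \<B>_def by blast
    qed
  qed
  then have "num_cliques G s \<le> card ({K. K \<subseteq> pverts G - A \<and> card K = s} \<union> (\<Union>a\<in>A. \<B> a))"
    unfolding num_cliques_def using finV finA finN
    by (intro card_mono) (auto simp: \<B>_def)
  also have "\<dots> \<le> card {K. K \<subseteq> pverts G - A \<and> card K = s} + (\<Sum>a\<in>A. card (\<B> a))"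
    using card_UN_le[OF finA, of \<B>] by (intro order_trans[OF card_Un_le]) simp
  also have "\<dots> \<le> (card (pverts G - A) choose s) + (\<Sum>a\<in>A. card (?N a) choose (s - 1))"
  proof (intro add_mono sum_mono)
    show "card {K. K \<subseteq> pverts G - A \<and> card K = s} \<le> card (pverts G - A) choose s"
      using finV by (simp add: n_subsets)
    show "card (\<B> a) \<le> card (?N a) choose (s - 1)" for a
      unfolding \<B>_def using finN[of a]
      by (intro order_trans[OF card_image_le]) (auto simp: n_subsets)
  qed
  finally show ?thesis .
qed

section \<open>Convexity of the bound\<close>

text \<open>The increments do not decrease. Hence one nonnegative increment before \<open>k\<close>
  forces a rise from \<open>k\<close> to \<open>b\<close>, and otherwise the sequence falls from
  \<open>a\<close> to \<open>k\<close>.\<close>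

lemma convex_seq_le_max_endpoints:
  fixes f :: "nat \<Rightarrow> int"
  assumes convex: "\<And>i. a \<le> i \<Longrightarrow> Suc i < b \<Longrightarrow> f (Suc i) - f i \<le> f (Suc (Suc i)) - f (Suc i)"
    and "a \<le> k" "k \<le> b"
  shows "f k \<le> max (f a) (f b)"
proof -
  have mono: "f (Suc i) - f i \<le> f (Suc j) - f j" if "i \<le> j" "a \<le> i" "j < b" for i j
    using that
  proof (induction j rule: dec_induct)
    case (step j)
    then show ?case using convex[of j] by simp
  qed simp
  show ?thesis
  proof (cases "\<exists>i. a \<le> i \<and> i < k \<and> f (Suc i) \<ge> f i")
    case True
    then obtain i where i: "a \<le> i" "i < k" "f (Suc i) \<ge> f i" by blast
    have "f k \<le> f b" using \<open>k \<le> b\<close>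
    proof (induction b rule: dec_induct)
      case (step m)
      then show ?case using mono[of i m] i by simp
    qed simp
    then show ?thesis by simp
  next
    case False
    then have dec: "f (Suc j) < f j" if "a \<le> j" "j < k" for j using that by force
    have "f k \<le> f a" using \<open>a \<le> k\<close>
    proof (induction rule: dec_induct)
      case (step j)
      then show ?case using dec[of j] by simp
    qed simp
    then show ?thesis by simp
  qed
qed

text \<open>This is the count obtained from \<open>k - t\<close> vertices of degree at most
  \<open>k\<close> and one further vertex of degree \<delta>.\<close>

definition clique_bound :: "nat \<Rightarrow> nat \<Rightarrow> nat \<Rightarrow> nat \<Rightarrow> nat \<Rightarrow> nat" where
  "clique_bound n t \<delta> s k =
    ((n + t - k - 1) choose s) + (k - t) * (k choose (s - 1)) + (\<delta> choose (s - 1))"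

text \<open>By Pascal's rule the increment at \<open>i\<close> is the sum of
  \<open>Suc i choose (s - 1)\<close> and \<open>(i - t) * (i choose (s - 2))\<close>, minus
  \<open>(n + t - i - 2) choose (s - 1)\<close>. The first two terms grow with \<open>i\<close> and
  the subtracted one shrinks, so the bound is convex.\<close>

lemma clique_bound_le_max:
  assumes "s \<ge> 2" "t < \<delta>" "\<delta> \<le> k" "k \<le> h" "h + 2 \<le> n + t"
  shows "clique_bound n t \<delta> s k \<le> max (clique_bound n t \<delta> s \<delta>) (clique_bound n t \<delta> s h)"
proof -
  obtain r where s: "s = Suc (Suc r)" using le_Suc_ex[OF assms(1)] by auto
  let ?f = "\<lambda>k. int (clique_bound n t \<delta> s k)"
  have diff: "?f (Suc i) - ?f i = int (Suc i choose Suc r) + int (i - t) * int (i choose r)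
      - int ((n + t - i - 2) choose Suc r)"
    if i: "\<delta> \<le> i" "i < h" for i
  proof -
    obtain m where m: "i = t + m" using le_Suc_ex[of t i] i assms by auto
    have 1: "n + t - i - 1 = Suc (n + t - i - 2)" "n + t - Suc i - 1 = n + t - i - 2"
      "Suc i - t = Suc m" "i - t = m"
      using i assms m by auto
    show ?thesis unfolding clique_bound_def s 1 by (simp add: algebra_simps)
  qed
  have "?f k \<le> max (?f \<delta>) (?f h)"
  proof (rule convex_seq_le_max_endpoints[of \<delta> h ?f k])
    fix i assume i: "\<delta> \<le> i" "Suc i < h"
    have "Suc i choose Suc r \<le> Suc (Suc i) choose Suc r" "i choose r \<le> Suc i choose r"
      "(n + t - Suc i - 2) choose Suc r \<le> (n + t - i - 2) choose Suc r"
      by (rule binomial_right_mono, simp)+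
    moreover have "(i - t) * (i choose r) \<le> (Suc i - t) * (Suc i choose r)"
      by (intro mult_mono binomial_right_mono) auto
    then have "int (i - t) * int (i choose r) \<le> int (Suc i - t) * int (Suc i choose r)"
      by (metis of_nat_le_iff of_nat_mult)
    ultimately show "?f (Suc i) - ?f i \<le> ?f (Suc (Suc i)) - ?f (Suc i)"
      using diff[of i] diff[of "Suc i"] i by linarith
  qed (use assms in auto)
  then show ?thesis by linarith
qed

section \<open>Low-degree vertices in a graph without a spider\<close>

theorem theorem2p5:
  fixes G :: "'a pair_pre_digraph" and n s t \<delta> :: nat
  assumes "s \<ge> 2"
    and "3 \<le> t + 1" and "t + 1 \<le> \<delta>" and "\<delta> \<le> h_bound n t"
    and "pair_graph G" and "Digraph_Component.connected (with_proj G)"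
    and "card (pverts G) = n" and "min_degree G = \<delta>"
    and "num_cliques G s > max (f1 n t \<delta> s) (g1 n t \<delta> s)"
  shows "one_to_many_disjoint_path_coverable t G"
proof (rule ccontr)
  interpret pair_graph G by (rule assms(5))
  let ?V = "pverts G" and ?E = "parcs G"
  define d where "d v = card (?E `` {v})" for v
  have finV: "finite ?V" by (rule pair_finite_verts)
  have E: "?E \<subseteq> ?V \<times> ?V" "sym ?E" "irrefl ?E"
    using pair_sym_arcs pair_no_loops[of "(a, a)" for a]
    by (auto simp: symmetric_def irrefl_def dest: in_arcsD1 in_arcsD2)
  have out_deg: "out_degree (with_proj G) v = d v" for v
  proof -
    have "out_arcs (with_proj G) v = Pair v ` (?E `` {v})" by (auto simp: out_arcs_def)
    then show ?thesis unfolding out_degree_def d_def by (simp add: card_image inj_on_def)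
  qed
  have \<delta>_eq: "\<delta> = Min (d ` ?V)" using assms(8) unfolding min_degree_def out_deg by simp
  assume "\<not> one_to_many_disjoint_path_coverable t G"
  then obtain u S where uS: "u \<in> ?V" "S \<subseteq> ?V" "finite S" "card S = t" "u \<notin> S"
    and none: "\<nexists>P. spider ?V ?E u S P"
    unfolding one_to_many_disjoint_path_coverable_iff_spider by blast
  have cardS: "card S \<ge> 2" using uS(4) assms(2) by simp
  obtain M where M: "?E \<subseteq> M" "M \<subseteq> ?V \<times> ?V" "sym M" "irrefl M" "\<nexists>Q. spider ?V M u S Q"
    and sum_le: "\<And>x y. x \<in> ?V \<Longrightarrow> y \<in> ?V \<Longrightarrow> x \<noteq> y \<Longrightarrow> (x, y) \<notin> M \<Longrightarrow>
      card (M `` {x}) + card (M `` {y}) + 2 \<le> card ?V + card S"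
    by (rule obtain_maximal_spiderless[OF finV uS(3) cardS uS(5) E none]) (rule that)
  \<comment> \<open>\<open>D\<close> is the degree in the maximal graph \<open>M\<close>, where the
    extremal pair is chosen; \<open>d\<close> is the degree in \<open>G\<close>, where cliques are
    counted. Upper bounds on \<open>D\<close> pass to \<open>d\<close>.\<close>
  define D where "D v = card (M `` {v})" for v
  have finM: "finite (M `` {v})" for v
    using finV by (rule finite_subset[rotated]) (use M in auto)
  have d_le_D: "d v \<le> D v" for v
    unfolding d_def D_def using M(1) finM by (intro card_mono) auto
  have \<delta>_le_d: "\<delta> \<le> d v" if "v \<in> ?V" for v using that finV by (simp add: \<delta>_eq)
  have "\<delta> \<in> d ` ?V" unfolding \<delta>_eq using finV uS(1) by (intro Min_in) auto
  then obtain w where w: "w \<in> ?V" "d w = \<delta>" by blast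
  define N where "N = {(x, y). x \<in> ?V \<and> y \<in> ?V \<and> x \<noteq> y \<and> (x, y) \<notin> M}"
  have "N \<noteq> {}"
  proof
    assume "N = {}"
    then have "\<exists>P. spider ?V M u S P"
      using uS cardS by (intro spider_complete[OF finV]) (auto simp: N_def)
    then show False using M by blast
  qed
  moreover have "finite N"
    by (rule finite_subset[of _ "?V \<times> ?V"]) (auto simp: N_def finV)
  ultimately have "Max ((\<lambda>(a, b). D a + D b) ` N) \<in> (\<lambda>(a, b). D a + D b) ` N"
    by (intro Max_in) auto
  moreover have D_le_Max: "D a + D b \<le> Max ((\<lambda>(a, b). D a + D b) ` N)" if "(a, b) \<in> N" for a b
    using \<open>finite N\<close> that by (intro Max_ge) force+
  ultimately obtain a b where ab: "(a, b) \<in> N" "D a + D b = Max ((\<lambda>(a, b). D a + D b) ` N)"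
    by auto
  have "(b, a) \<in> N" using ab(1) M(3) by (auto simp: N_def dest: symD)
  then obtain x y where xy: "(x, y) \<in> N" "D x \<le> D y" "D x + D y = D a + D b"
    using ab(1) by (metis add.commute nle_le)
  have max: "D v + D v' \<le> D x + D y" if "(v, v') \<in> N" for v v'
    using D_le_Max[OF that] ab(2) xy(3) by simp
  define k where "k = D x"
  have xyV: "x \<in> ?V" "y \<in> ?V" "x \<noteq> y" "(x, y) \<notin> M" using xy by (auto simp: N_def)
  have sum: "D x + D y + 2 \<le> n + t" using sum_le[OF xyV] uS(4) assms(7) by (simp add: D_def)
  have k_ge: "\<delta> \<le> k" using \<delta>_le_d[OF xyV(1)] d_le_D[of x] by (simp add: k_def)
  have k_le: "k \<le> h_bound n t" using sum xy(2) by (simp add: k_def h_bound_def)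
  \<comment> \<open>The vertices of \<open>B\<close> are not adjacent to \<open>y\<close> in
    \<open>M\<close>. Maximality of \<open>D x + D y\<close> gives each of them degree at most
    \<open>D x = k\<close>, and the degree sum bound makes \<open>B\<close> large.\<close>
  define B where "B = ?V - {y} - M `` {y}"
  have "M `` {y} \<subseteq> ?V - {y}" using M(2,4) by (auto simp: irrefl_def)
  then have "card B = n - 1 - D y"
    unfolding B_def D_def using xyV(2) assms(7) finM by (simp add: card_Diff_subset)
  then have cardB: "k - t + 1 \<le> card B" using sum k_ge assms(3) by (simp add: k_def)
  have dB: "d v \<le> k" if "v \<in> B" for v
  proof -
    have "(y, v) \<in> N" using that xyV by (auto simp: B_def N_def)
    then show ?thesis using max[of y v] d_le_D[of v] by (simp add: k_def)
  qed
  \<comment> \<open>\<open>B\<close> has one vertex to spare, so \<open>k - t\<close> of its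
    vertices other than \<open>w\<close> exist whether or not \<open>w\<close> lies in
    \<open>B\<close>. Adding \<open>w\<close>, of degree \<delta>, gives \<open>k - t + 1\<close>
    vertices in either case.\<close>
  have "k - t \<le> card (B - {w})"
    using cardB by (cases "w \<in> B") (auto simp: card_Diff_singleton)
  then obtain C where C: "C \<subseteq> B - {w}" "card C = k - t" "finite C"
    by (metis obtain_subset_with_card_n)
  define A where "A = insert w C"
  have "w \<notin> C" using C(1) by blast
  then have A: "A \<subseteq> ?V" "card A = k - t + 1" "finite A"
    using C w by (auto simp: A_def B_def)
  have "num_cliques G s \<le> (card (?V - A) choose s) + (\<Sum>a\<in>A. d a choose (s - 1))"
    unfolding d_def by (rule num_cliques_le[OF assms(5) A(1)])
  also have "card (?V - A) = n + t - k - 1"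
    using A k_ge assms(3,7) by (simp add: card_Diff_subset)
  also have "(\<Sum>a\<in>A. d a choose (s - 1)) = (\<delta> choose (s - 1)) + (\<Sum>a\<in>C. d a choose (s - 1))"
    using \<open>w \<notin> C\<close> C w by (simp add: A_def)
  also have "(\<Sum>a\<in>C. d a choose (s - 1)) \<le> (k - t) * (k choose (s - 1))"
  proof -
    have "d a choose (s - 1) \<le> k choose (s - 1)" if "a \<in> C" for a
      using that C(1) dB by (intro binomial_right_mono) blast
    then show ?thesis
      using sum_bounded_above[of C "\<lambda>a. d a choose (s - 1)" "k choose (s - 1)"] C(2) by simp
  qed
  finally have "num_cliques G s \<le> clique_bound n t \<delta> s k"
    by (simp add: clique_bound_def)
  also have "\<dots> \<le> max (clique_bound n t \<delta> s \<delta>) (clique_bound n t \<delta> s (h_bound n t))"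
    using assms(1-4) k_ge k_le by (intro clique_bound_le_max) (auto simp: h_bound_def)
  \<comment> \<open>At \<open>k = \<delta>\<close> the separate summand for \<open>w\<close> merges
    with the other \<open>\<delta> - t\<close> equal ones.\<close>
  also have "clique_bound n t \<delta> s \<delta> = f1 n t \<delta> s"
    using assms(3) by (simp add: clique_bound_def f1_def)
  also have "clique_bound n t \<delta> s (h_bound n t) = g1 n t \<delta> s"
    by (simp add: clique_bound_def g1_def Let_def)
  finally show False using assms(9) by simp
qed

end
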